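(* Let $\mathcal{H}$ be a real Hilbert space, let $n\ge1$ be an integer and $m:=2n-1$. Let $U_1,\ldots,U_n$ be closed linear subspaces of $\mathcal{H}$ with $U_1^\perp+\cdots+U_n^\perp$ closed, and set $U_{n+i}:=U_{n-i}$ for $i\in\{1,\ldots,n-1\}$. Let $$\Omega:=\{\mathrm{R}_{U_{i_r}}\cdots\mathrm{R}_{U_{i_2}}\mathrm{R}_{U_{i_1}} : r\in\mathbb{N},\ i_1,\ldots,i_r\in\{1,\ldots,m\}\},$$ $$\Psi:=\{\mathrm{R}_{U_{i_r}}\cdots\mathrm{R}_{U_{i_2}}\mathrm{R}_{U_{i_1}} : r\in\{0,1,\ldots,m\},\ i_1,\ldots,i_r\in\{1,\ldots,m\},\ i_1<\cdots<i_r\},$$ (with the empty product, $r=0$, equal to $\mathrm{Id}$), and let $\mathcal{S}$ be a finite set with $\Psi\subseteq\mathcal{S}\subseteq\Omega$. Set $\gamma:=\big\|\mathrm{P}_{U_n}\mathrm{P}_{U_{n-1}}\cdots\mathrm{P}_{U_1}\mathrm{P}_{(\bigcap_{i=1}^nU_i)^\perp}\big\|$. Then $\gamma\in[0,1[$, $\operatorname{Fix}CC_{\mathcal{S}}=\bigcap_{i=1}^mU_i$, and the circumcenter mapping $CC_{\mathcal{S}}$ is a $\gamma^2$-BAM.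
   Context: For a nonempty closed convex set $C\subseteq\mathcal{H}$, $\mathrm{P}_C$ denotes the metric projection onto $C$ and $\mathrm{R}_C:=2\mathrm{P}_C-\mathrm{Id}$ the reflector. $\operatorname{Fix}G=\{x\in\mathcal{H}: Gx=x\}$. $\mathbb{N}=\{0,1,2,\ldots\}$. Products of operators denote composition; $\|\cdot\|$ of a bounded linear operator is the operator norm. Definition (BAM). Let $G:\mathcal{H}\to\mathcal{H}$ and $\gamma\in[0,1[$. $G$ is a best approximation mapping with constant $\gamma$ ($\gamma$-BAM) if (1) $\operatorname{Fix}G$ is a nonempty closed convex subset of $\mathcal{H}$; (2) $\mathrm{P}_{\operatorname{Fix}G}G=\mathrm{P}_{\operatorname{Fix}G}$; (3) $\|Gx-\mathrm{P}_{\operatorname{Fix}G}x\|\le\gamma\|x-\mathrm{P}_{\operatorname{Fix}G}x\|$ for all $x\in\mathcal{H}$. Circumcenter mapping: for a finite set $\mathcal{S}$ of affine isometries of $\mathcal{H}$ having a common fixed point (e.g. compositions of reflectors in closed linear subspaces), and $x\in\mathcal{H}$, $CC_{\mathcal{S}}x$ is the unique point $p$ in the affine hull of $\mathcal{S}(x)=\{Tx:T\in\mathcal{S}\}$ such that $\{\|p-Tx\|:T\in\mathcal{S}\}$ is a singleton. It is a known fact that such a point exists and is unique for every $x$, so $CC_{\mathcal{S}}:\mathcal{H}\to\mathcal{H}$ is well defined. *)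

theory Defs
  imports "HOL-Analysis.Analysis" "HOL-Library.Set_Algebras"
begin

text \<open>A real Hilbert space is a type of sort \<open>{real_inner, complete_space}\<close>. The library's
  \<open>closest_point\<close> requires the class \<open>heine_borel\<close>, which excludes infinite-dimensional spaces.\<close>

definition metric_proj :: "'a::real_inner set \<Rightarrow> 'a \<Rightarrow> 'a" where
  "metric_proj C x = (THE p. p \<in> C \<and> (\<forall>y\<in>C. dist x p \<le> dist x y))"

definition reflector :: "'a::real_inner set \<Rightarrow> 'a \<Rightarrow> 'a" where
  "reflector C x = 2 *\<^sub>R metric_proj C x - x"

definition Fix :: "('a \<Rightarrow> 'a) \<Rightarrow> 'a set" where
  "Fix G = {x. G x = x}"

definition BAM :: "real \<Rightarrow> ('a::real_inner \<Rightarrow> 'a) \<Rightarrow> bool" where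
  "BAM \<gamma> G \<longleftrightarrow>
     0 \<le> \<gamma> \<and> \<gamma> < 1 \<and>
     Fix G \<noteq> {} \<and> closed (Fix G) \<and> convex (Fix G) \<and>
     metric_proj (Fix G) \<circ> G = metric_proj (Fix G) \<and>
     (\<forall>x. norm (G x - metric_proj (Fix G) x) \<le> \<gamma> * norm (x - metric_proj (Fix G) x))"

definition CC :: "('a::real_inner \<Rightarrow> 'a) set \<Rightarrow> 'a \<Rightarrow> 'a" where
  "CC S x = (THE p. p \<in> affine hull ((\<lambda>T. T x) ` S) \<and>
                    is_singleton ((\<lambda>T. norm (p - T x)) ` S))"

text \<open>\<open>op_prod F [i\<^sub>1, \<dots>, i\<^sub>r]\<close> is the composition \<open>F i\<^sub>r \<circ> \<dots> \<circ> F i\<^sub>1\<close>: the head of the list acts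
  first, and the empty list gives the identity.\<close>

definition op_prod :: "('i \<Rightarrow> 'a \<Rightarrow> 'a) \<Rightarrow> 'i list \<Rightarrow> 'a \<Rightarrow> 'a" where
  "op_prod F ks = fold (\<lambda>i T. F i \<circ> T) ks id"

definition Omega :: "nat \<Rightarrow> (nat \<Rightarrow> 'a::real_inner set) \<Rightarrow> ('a \<Rightarrow> 'a) set" where
  "Omega m U = {op_prod (\<lambda>i. reflector (U i)) ks | ks. set ks \<subseteq> {1..m}}"

definition Psi :: "nat \<Rightarrow> (nat \<Rightarrow> 'a::real_inner set) \<Rightarrow> ('a \<Rightarrow> 'a) set" where
  "Psi m U = {op_prod (\<lambda>i. reflector (U i)) ks | ks.
                length ks \<le> m \<and> set ks \<subseteq> {1..m} \<and> sorted_wrt (<) ks}"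

end

theory Submission
  imports Defs
begin

text \<open>Write \<open>M\<close> for the intersection of the subspaces and \<open>T = P\<^sub>n \<cdots> P\<^sub>1\<close>. The maps in \<open>S\<close> are linear
  isometries fixing \<open>M\<close> pointwise, so \<open>CC S x\<close> is the point of the affine hull of the orbit of \<open>x\<close>
  that is nearest to any prescribed point of \<open>M\<close>, in particular to \<open>P\<^sub>M x\<close>. Expanding every projection
  as the mean of the identity and its reflector puts \<open>P\<^sub>m \<cdots> P\<^sub>1 x\<close> into that affine hull, and the
  palindromic order of the subspaces makes \<open>P\<^sub>m \<cdots> P\<^sub>1\<close> the product of the adjoint of \<open>T\<close> with \<open>T\<close>,
  whose norm on the complement of \<open>M\<close> is at most \<open>\<gamma>\<^sup>2\<close>.

  That \<open>\<gamma> < 1\<close> comes from linear regularity: on the complement of \<open>M\<close> the norm of \<open>y\<close> is at most a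
  constant times the sum of its distances to the \<open>U\<^sub>i\<close>. Since the sum of the complements of the
  \<open>U\<^sub>i\<close> is closed, it is the complement of \<open>M\<close>, and splitting test vectors along it shows that the
  set of those \<open>y\<close> whose distances sum to at most 1 is weakly bounded, hence bounded. The distances
  in turn are controlled by the loss of norm along \<open>T\<close>.\<close>

subsection \<open>Orthogonal projections and reflectors\<close>

text \<open>Pythagoras for \<open>x - p\<close> and \<open>p - y\<close> makes \<open>p\<close> the
  only minimiser. All later evaluations of \<open>metric_proj\<close> go through this orthogonality
  criterion instead of the definite description.\<close>

lemma subspace_projection_unique:
  fixes M :: "'a::real_inner set"
  assumes "subspace M" "p \<in> M" "\<And>y. y \<in> M \<Longrightarrow> (x - p) \<bullet> y = 0"
  shows "metric_proj M x = p"
proof -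
  have pyth: "(dist x y)\<^sup>2 = (dist x p)\<^sup>2 + (dist p y)\<^sup>2" if "y \<in> M" for y
  proof -
    have "(x - p) \<bullet> (p - y) = 0"
      using assms that by (simp add: subspace_diff)
    then show ?thesis
      using norm_add_Pythagorean[of "x - p" "p - y"] by (simp add: orthogonal_def dist_norm)
  qed
  show ?thesis
    unfolding metric_proj_def
  proof (rule the_equality)
    have "dist x p \<le> dist x y" if "y \<in> M" for y
      using pyth[OF that] by (simp add: power2_le_imp_le)
    then show "p \<in> M \<and> (\<forall>y\<in>M. dist x p \<le> dist x y)"
      using assms(2) by blast
  next
    fix q assume q: "q \<in> M \<and> (\<forall>y\<in>M. dist x q \<le> dist x y)"
    then have "(dist x q)\<^sup>2 \<le> (dist x p)\<^sup>2"
      using assms(2) by (auto intro!: power_mono)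
    with pyth[of q] q show "q = p" by simp
  qed
qed

text \<open>A minimising sequence is Cauchy by the parallelogram law, and completeness supplies its
  limit.\<close>

lemma ex_nearest_point_complete_subspace:
  fixes M :: "'a::real_inner set"
  assumes "subspace M" "complete M"
  shows "\<exists>p\<in>M. \<forall>y\<in>M. dist x p \<le> dist x y"
proof -
  define d where "d = infdist x M"
  have ne: "M \<noteq> {}" using assms(1) subspace_0 by blast
  have d_le: "d \<le> dist x y" if "y \<in> M" for y
    unfolding d_def using that by (rule infdist_le)
  have d0: "d \<ge> 0" unfolding d_def by (rule infdist_nonneg)
  have "\<exists>p\<in>M. dist x p < d + inverse (real (Suc k))" for k
  proof -
    have "Inf (dist x ` M) < d + inverse (real (Suc k))"
      using ne by (simp add: d_def infdist_notempty)
    then show ?thesis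
      using ne by (subst (asm) cInf_less_iff) auto
  qed
  then obtain p where pM: "\<And>k. p k \<in> M" and pd: "\<And>k. dist x (p k) < d + inverse (real (Suc k))"
    by metis
  \<comment> \<open>The midpoint \<open>c\<close> of two members of the sequence lies in
    \<open>M\<close>, so its distance from \<open>x\<close> is at least \<open>d\<close>; the
    parallelogram identity then bounds the gap between the two members.\<close>
  have dist2: "(dist (p i) (p j))\<^sup>2 \<le> 2 * ((dist x (p i))\<^sup>2 - d\<^sup>2) + 2 * ((dist x (p j))\<^sup>2 - d\<^sup>2)" for i j
  proof -
    define c where "c = (1/2) *\<^sub>R (p i + p j)"
    have "c \<in> M"
      unfolding c_def using pM assms(1) by (simp add: subspace_add subspace_scale)
    then have "d\<^sup>2 \<le> (dist x c)\<^sup>2"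
      using d_le d0 by (auto intro!: power_mono)
    moreover have "(dist (p i) (p j))\<^sup>2 = 2 * (dist x (p i))\<^sup>2 + 2 * (dist x (p j))\<^sup>2
        - 4 * (dist x c)\<^sup>2"
      unfolding c_def dist_norm power2_norm_eq_inner
      by (simp add: inner_simps inner_commute algebra_simps)
    ultimately show ?thesis unfolding right_diff_distrib by linarith
  qed
  have dlim: "(\<lambda>k. dist x (p k)) \<longlonglongrightarrow> d"
  proof (rule tendsto_sandwich[of "\<lambda>_. d"])
    show "(\<lambda>k. d + inverse (real (Suc k))) \<longlonglongrightarrow> d"
      by (rule LIMSEQ_inverse_real_of_nat_add)
    show "\<forall>\<^sub>F k in sequentially. dist x (p k) \<le> d + inverse (real (Suc k))"
      using pd by (simp add: less_imp_le)
  qed (use d_le pM in auto)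
  have "Cauchy p"
  proof (rule metric_CauchyI)
    fix e :: real assume e: "0 < e"
    have "(\<lambda>k. (dist x (p k))\<^sup>2 - d\<^sup>2) \<longlonglongrightarrow> d\<^sup>2 - d\<^sup>2"
      by (intro tendsto_intros dlim)
    then have "\<forall>\<^sub>F k in sequentially. (dist x (p k))\<^sup>2 - d\<^sup>2 < e\<^sup>2 / 4"
      using e by (intro order_tendstoD(2)[of _ "d\<^sup>2 - d\<^sup>2"]) auto
    then obtain N where N: "\<And>k. k \<ge> N \<Longrightarrow> (dist x (p k))\<^sup>2 - d\<^sup>2 < e\<^sup>2 / 4"
      unfolding eventually_sequentially by blast
    have "dist (p i) (p j) < e" if "i \<ge> N" "j \<ge> N" for i j
    proof -
      have "(dist (p i) (p j))\<^sup>2 < e\<^sup>2"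
        using dist2[of i j] N[OF that(1)] N[OF that(2)] unfolding right_diff_distrib by linarith
      then show ?thesis
        using e by (simp add: power2_less_imp_less)
    qed
    then show "\<exists>N. \<forall>i\<ge>N. \<forall>j\<ge>N. dist (p i) (p j) < e" by blast
  qed
  then obtain q where q: "q \<in> M" "p \<longlonglongrightarrow> q"
    using assms(2) pM unfolding complete_def by blast
  have "(\<lambda>k. dist x (p k)) \<longlonglongrightarrow> dist x q"
    by (intro tendsto_intros q)
  then have "dist x q = d"
    using dlim LIMSEQ_unique by blast
  then show ?thesis using q d_le by auto
qed

lemma nearest_point_orthogonal:
  fixes M :: "'a::real_inner set"
  assumes "subspace M" "p \<in> M" "\<And>y. y \<in> M \<Longrightarrow> dist x p \<le> dist x y" "y \<in> M"
  shows "(x - p) \<bullet> y = 0"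
proof (cases "y = 0")
  case False
  \<comment> \<open>This \<open>t\<close> minimises the quadratic
    \<open>t \<mapsto> (dist x (p + t *\<^sub>R y))\<^sup>2\<close>, whose minimum would lie below
    \<open>(dist x p)\<^sup>2\<close> unless the inner product vanishes.\<close>
  define t where "t = ((x - p) \<bullet> y) / (y \<bullet> y)"
  have "dist x p \<le> dist x (p + t *\<^sub>R y)"
    using assms by (simp add: subspace_add subspace_scale)
  then have "(dist x p)\<^sup>2 \<le> (dist x (p + t *\<^sub>R y))\<^sup>2"
    by (auto intro!: power_mono)
  also have "\<dots> = (dist x p)\<^sup>2 - 2 * t * ((x - p) \<bullet> y) + t\<^sup>2 * (y \<bullet> y)"
    unfolding dist_norm power2_norm_eq_inner
    by (simp add: inner_simps inner_commute algebra_simps power2_eq_square)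
  also have "\<dots> = (dist x p)\<^sup>2 - ((x - p) \<bullet> y)\<^sup>2 / (y \<bullet> y)"
    using False by (simp add: t_def power2_eq_square)
  finally have "((x - p) \<bullet> y)\<^sup>2 / (y \<bullet> y) \<le> 0" by simp
  moreover have "y \<bullet> y > 0" using False by simp
  ultimately show ?thesis
    by (simp add: divide_le_0_iff not_less flip: not_le)
qed simp

context
  fixes M :: "'a::{real_inner, complete_space} set"
  assumes subspace: "subspace M" and closed: "closed M"
begin

lemma metric_proj_mem_orthogonal:
  "metric_proj M x \<in> M \<and> (\<forall>y\<in>M. (x - metric_proj M x) \<bullet> y = 0)"
proof -
  obtain p where "p \<in> M" "\<forall>y\<in>M. dist x p \<le> dist x y"
    using ex_nearest_point_complete_subspace[OF subspace] closed
    by (metis complete_eq_closed)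
  then have "p \<in> M \<and> (\<forall>y\<in>M. (x - p) \<bullet> y = 0)"
    using nearest_point_orthogonal[OF subspace] by blast
  then show ?thesis
    using subspace_projection_unique[OF subspace] by metis
qed

lemma metric_proj_mem: "metric_proj M x \<in> M"
  and metric_proj_orthogonal: "y \<in> M \<Longrightarrow> (x - metric_proj M x) \<bullet> y = 0"
  using metric_proj_mem_orthogonal by blast+

lemma metric_proj_id: "x \<in> M \<Longrightarrow> metric_proj M x = x"
  by (rule subspace_projection_unique[OF subspace]) auto

lemma linear_metric_proj: "linear (metric_proj M)"
proof (rule linearI)
  note P = metric_proj_mem metric_proj_orthogonal
  show "metric_proj M (x + y) = metric_proj M x + metric_proj M y" for x y
  proof (rule subspace_projection_unique[OF subspace])
    show "(x + y - (metric_proj M x + metric_proj M y)) \<bullet> z = 0" if "z \<in> M" for z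
      using P(2)[OF that, of x] P(2)[OF that, of y] by (simp add: inner_simps)
  qed (use P subspace in \<open>simp add: subspace_add\<close>)
  show "metric_proj M (r *\<^sub>R x) = r *\<^sub>R metric_proj M x" for r x
  proof (rule subspace_projection_unique[OF subspace])
    show "(r *\<^sub>R x - r *\<^sub>R metric_proj M x) \<bullet> z = 0" if "z \<in> M" for z
      using P(2)[OF that, of x] by (simp add: inner_simps)
  qed (use P subspace in \<open>simp add: subspace_scale\<close>)
qed

lemma metric_proj_inner: "metric_proj M x \<bullet> y = x \<bullet> metric_proj M y"
  using metric_proj_orthogonal[OF metric_proj_mem, of x y]
    metric_proj_orthogonal[OF metric_proj_mem, of y x]
  by (simp add: inner_simps inner_commute)

lemma metric_proj_Pythagorean:
  "(norm x)\<^sup>2 = (norm (metric_proj M x))\<^sup>2 + (norm (x - metric_proj M x))\<^sup>2"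
  using metric_proj_orthogonal[OF metric_proj_mem, of x x]
  unfolding power2_norm_eq_inner by (simp add: inner_simps inner_commute)

lemma norm_metric_proj_le: "norm (metric_proj M x) \<le> norm x"
  using metric_proj_Pythagorean[of x] by (simp add: power2_le_imp_le)

lemma bounded_linear_metric_proj: "bounded_linear (metric_proj M)"
  using linear_metric_proj norm_metric_proj_le
  by (intro bounded_linear_intro[where K = 1]) (auto simp: linear_add linear_scale)

lemma linear_reflector: "linear (reflector M)"
  unfolding reflector_def
  by (intro linear_compose_sub linear_compose_scale_right linear_metric_proj linear_ident)

lemma norm_reflector: "norm (reflector M x) = norm x"
proof -
  have "(norm (reflector M x))\<^sup>2 = (norm x)\<^sup>2"
    using metric_proj_orthogonal[OF metric_proj_mem, of x x]
    unfolding reflector_def power2_norm_eq_inner by (simp add: inner_simps inner_commute)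
  then show ?thesis by simp
qed

lemma reflector_inner_fixed: "z \<in> M \<Longrightarrow> z \<bullet> reflector M x = z \<bullet> x"
  using metric_proj_orthogonal[of z x]
  by (simp add: reflector_def inner_simps inner_commute)

lemma metric_proj_orthogonal_comp: "metric_proj (orthogonal_comp M) x = x - metric_proj M x"
  by (rule subspace_projection_unique[OF subspace_orthogonal_comp])
    (use metric_proj_mem metric_proj_orthogonal in
      \<open>auto simp: orthogonal_comp_def orthogonal_def inner_commute\<close>)

text \<open>For \<open>x\<close> in the double complement, the residual
  \<open>x - metric_proj M x\<close> is orthogonal both to \<open>x\<close> and to its projection,
  hence to itself.\<close>

lemma orthogonal_comp_orthogonal_comp: "orthogonal_comp (orthogonal_comp M) = M"
proof
  show "orthogonal_comp (orthogonal_comp M) \<subseteq> M"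
  proof
    fix x assume x: "x \<in> orthogonal_comp (orthogonal_comp M)"
    let ?r = "x - metric_proj M x"
    have r: "?r \<in> orthogonal_comp M"
      using metric_proj_orthogonal by (auto simp: orthogonal_comp_def orthogonal_def inner_commute)
    then have "?r \<bullet> x = 0"
      using x by (auto simp: orthogonal_comp_def orthogonal_def)
    moreover have "?r \<bullet> metric_proj M x = 0"
      by (intro metric_proj_orthogonal metric_proj_mem)
    ultimately have "?r \<bullet> ?r = 0" by (simp add: inner_diff_right)
    then have "metric_proj M x = x" by simp
    then show "x \<in> M" using metric_proj_mem by metis
  qed
qed (rule orthogonal_comp_subset)

end

subsection \<open>Compositions of operators\<close>

lemma op_prod_Nil [simp]: "op_prod F [] = id"
  by (simp add: op_prod_def)

lemma op_prod_snoc [simp]: "op_prod F (ks @ [k]) = F k \<circ> op_prod F ks"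
  by (simp add: op_prod_def)

lemma linear_op_prod:
  assumes "\<And>i. i \<in> set ks \<Longrightarrow> linear (F i)"
  shows "linear (op_prod F ks)"
  using assms
proof (induction ks rule: rev_induct)
  case Nil
  show ?case by (simp add: id_def linear_ident)
next
  case (snoc k ks)
  then show ?case using linear_compose[of "op_prod F ks" "F k"] by (simp add: comp_def)
qed

lemma op_prod_append: "op_prod F (ks @ ls) = op_prod F ls \<circ> op_prod F ks"
proof (induction ls rule: rev_induct)
  case (snoc l ls)
  show ?case
    by (simp add: snoc.IH comp_assoc flip: append_assoc)
qed simp

lemma op_prod_Cons [simp]: "op_prod F (k # ks) = op_prod F ks \<circ> F k"
  using op_prod_append[of F "[k]" ks] op_prod_snoc[of F "[]" k] by simp

lemma op_prod_map: "op_prod F (map g ks) = op_prod (\<lambda>i. F (g i)) ks"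
  by (simp add: op_prod_def fold_map comp_def)

lemma op_prod_fixed:
  assumes "\<And>i. i \<in> set ks \<Longrightarrow> F i z = z"
  shows "op_prod F ks z = z"
  using assms by (induction ks) auto

lemma norm_op_prod_reflector:
  fixes U :: "'i \<Rightarrow> 'a::{real_inner, complete_space} set"
  assumes "\<And>i. i \<in> set ks \<Longrightarrow> subspace (U i) \<and> closed (U i)"
  shows "norm (op_prod (\<lambda>i. reflector (U i)) ks x) = norm x"
  using assms by (induction ks arbitrary: x) (auto simp: norm_reflector)

lemma op_prod_reflector_inner_fixed:
  fixes U :: "'i \<Rightarrow> 'a::{real_inner, complete_space} set"
  assumes "\<And>i. i \<in> set ks \<Longrightarrow> subspace (U i) \<and> closed (U i) \<and> z \<in> U i"
  shows "z \<bullet> op_prod (\<lambda>i. reflector (U i)) ks x = z \<bullet> x"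
  using assms by (induction ks arbitrary: x) (auto simp: reflector_inner_fixed)

text \<open>The indices after \<open>n\<close> run back through the sets \<open>U (n - 1)\<close>,
  ..., \<open>U 1\<close>. Idempotence of the middle factor allows it to be written twice, once in
  each half.\<close>

lemma op_prod_palindrome:
  fixes U :: "nat \<Rightarrow> 'b"
  assumes n: "n \<ge> 1" and sym: "\<And>i. i \<in> {1..n - 1} \<Longrightarrow> U (n + i) = U (n - i)"
    and idem: "F (U n) \<circ> F (U n) = F (U n)"
  shows "op_prod (\<lambda>i. F (U i)) [1..<2 * n]
    = op_prod (\<lambda>i. F (U i)) (rev [1..<n + 1]) \<circ> op_prod (\<lambda>i. F (U i)) [1..<n + 1]"
proof -
  have "map U [n + 1..<2 * n] = map U (rev [1..<n])"
  proof (rule nth_equalityI)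
    fix j assume "j < length (map U [n + 1..<2 * n])"
    then have j: "j + 1 < n" by simp
    then have "U (n + (j + 1)) = U (n - (j + 1))" by (intro sym) auto
    with j show "map U [n + 1..<2 * n] ! j = map U (rev [1..<n]) ! j"
      by (simp add: rev_nth nth_append Suc_diff_Suc)
  qed simp
  then have tail: "op_prod (\<lambda>i. F (U i)) [n + 1..<2 * n] = op_prod (\<lambda>i. F (U i)) (rev [1..<n])"
    by (metis op_prod_map)
  have split: "[1..<2 * n] = [1..<n + 1] @ [n + 1..<2 * n]" "[1..<n + 1] = [1..<n] @ [n]"
    using n upt_add_eq_append[of 1 "n + 1" "n - 1"] by (simp_all add: mult_2)
  have "F (U n) \<circ> op_prod (\<lambda>i. F (U i)) [1..<n + 1] = op_prod (\<lambda>i. F (U i)) [1..<n + 1]"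
    unfolding split(2) op_prod_snoc by (simp only: idem flip: comp_assoc)
  then show ?thesis
    unfolding split(1) op_prod_append tail
    by (simp only: split(2) rev_append rev.simps append.simps op_prod_Cons comp_assoc)
qed

text \<open>Each projection is self-adjoint, so moving the factors across one at a time reverses
  their order.\<close>

lemma op_prod_metric_proj_inner:
  fixes U :: "'i \<Rightarrow> 'a::{real_inner, complete_space} set"
  assumes "\<And>i. i \<in> set ks \<Longrightarrow> subspace (U i) \<and> closed (U i)"
  shows "op_prod (\<lambda>i. metric_proj (U i)) ks x \<bullet> y
    = x \<bullet> op_prod (\<lambda>i. metric_proj (U i)) (rev ks) y"
  using assms
proof (induction ks arbitrary: y rule: rev_induct)
  case (snoc k ks)
  then show ?case
    by (simp add: metric_proj_inner)
qed simp

lemma norm_op_prod_metric_proj_le: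
  fixes U :: "'i \<Rightarrow> 'a::{real_inner, complete_space} set"
  assumes "\<And>i. i \<in> set ks \<Longrightarrow> subspace (U i) \<and> closed (U i)"
  shows "norm (op_prod (\<lambda>i. metric_proj (U i)) ks y) \<le> norm y"
  using assms
proof (induction ks rule: rev_induct)
  case (snoc k ks)
  let ?T = "op_prod (\<lambda>i. metric_proj (U i)) ks"
  have "norm (metric_proj (U k) (?T y)) \<le> norm (?T y)"
    using snoc.prems by (intro norm_metric_proj_le) auto
  also have "\<dots> \<le> norm y"
    using snoc by auto
  finally show ?case by simp
qed simp

lemma bounded_linear_op_prod_metric_proj:
  fixes U :: "'i \<Rightarrow> 'a::{real_inner, complete_space} set"
  assumes "\<And>i. i \<in> set ks \<Longrightarrow> subspace (U i) \<and> closed (U i)"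
  shows "bounded_linear (op_prod (\<lambda>i. metric_proj (U i)) ks)"
proof -
  have "linear (op_prod (\<lambda>i. metric_proj (U i)) ks)"
    using assms by (intro linear_op_prod linear_metric_proj) auto
  then show ?thesis
    using norm_op_prod_metric_proj_le[OF assms]
    by (intro bounded_linear_intro[where K = 1]) (auto simp: linear_add linear_scale)
qed

text \<open>Each projection moves a point by exactly its loss of squared norm, squared length for
  squared length. The losses telescope, and
  \<open>(a + b)\<^sup>2 \<le> 2 * a\<^sup>2 + 2 * b\<^sup>2\<close> costs a factor 2 per
  projection.\<close>

lemma displacement_op_prod_metric_proj:
  fixes U :: "'i \<Rightarrow> 'a::{real_inner, complete_space} set"
  assumes "\<And>i. i \<in> set ks \<Longrightarrow> subspace (U i) \<and> closed (U i)"
  shows "(norm (y - op_prod (\<lambda>i. metric_proj (U i)) ks y))\<^sup>2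
    \<le> 2 ^ length ks * ((norm y)\<^sup>2 - (norm (op_prod (\<lambda>i. metric_proj (U i)) ks y))\<^sup>2)"
  using assms
proof (induction ks rule: rev_induct)
  case (snoc k ks)
  define z where "z = op_prod (\<lambda>i. metric_proj (U i)) ks y"
  define w where "w = metric_proj (U k) z"
  have IH: "(norm (y - z))\<^sup>2 \<le> 2 ^ length ks * ((norm y)\<^sup>2 - (norm z)\<^sup>2)"
    using snoc unfolding z_def by auto
  have pyth: "(norm z)\<^sup>2 = (norm w)\<^sup>2 + (norm (z - w))\<^sup>2"
    unfolding w_def using snoc.prems by (intro metric_proj_Pythagorean) auto
  have "(norm (y - w))\<^sup>2 \<le> (norm (y - z) + norm (z - w))\<^sup>2"
    using norm_triangle_ineq[of "y - z" "z - w"] by (simp add: power_mono)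
  also have "\<dots> \<le> 2 * (norm (y - z))\<^sup>2 + 2 * (norm (z - w))\<^sup>2"
    using sum_squares_bound[of "norm (y - z)" "norm (z - w)"] by (simp add: power2_sum)
  \<comment> \<open>The second summand is enlarged by \<open>2 ^ length ks \<ge> 1\<close> so that
    both losses carry the same factor and add up.\<close>
  also have "\<dots> \<le> 2 * (2 ^ length ks * ((norm y)\<^sup>2 - (norm z)\<^sup>2))
      + 2 * (2 ^ length ks * (norm (z - w))\<^sup>2)"
    using mult_right_mono[of 1 "2 ^ length ks" "(norm (z - w))\<^sup>2"] IH by simp
  also have "\<dots> = 2 ^ length (ks @ [k]) * ((norm y)\<^sup>2 - (norm w)\<^sup>2)"
    unfolding pyth by (simp add: algebra_simps)
  finally show ?case by (simp add: z_def w_def)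
qed simp

text \<open>If \<open>i\<close> is the last index, the end point lies in \<open>U i\<close>, so the
  displacement dominates the distance to \<open>U i\<close>. Otherwise the bound for the shorter
  product carries over, because one more projection only increases the loss of norm.\<close>

lemma distance_le_norm_decrease_op_prod:
  fixes U :: "'i \<Rightarrow> 'a::{real_inner, complete_space} set"
  assumes "\<And>i. i \<in> set ks \<Longrightarrow> subspace (U i) \<and> closed (U i)" "i \<in> set ks"
  shows "(norm (y - metric_proj (U i) y))\<^sup>2
    \<le> 2 ^ length ks * ((norm y)\<^sup>2 - (norm (op_prod (\<lambda>i. metric_proj (U i)) ks y))\<^sup>2)"
  using assms
proof (induction ks rule: rev_induct)
  case (snoc k ks)
  let ?P = "\<lambda>i. metric_proj (U i)"
  define z where "z = op_prod ?P ks y"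
  define w where "w = op_prod ?P (ks @ [k]) y"
  have wz: "w = ?P k z" by (simp add: w_def z_def)
  have Uk: "subspace (U k)" "closed (U k)" using snoc.prems by auto
  show ?case
  proof (cases "i = k")
    case True
    let ?p = "?P k y"
    have "w \<in> U k" unfolding wz using Uk by (rule metric_proj_mem)
    then have "?p - w \<in> U k"
      using Uk by (intro subspace_diff metric_proj_mem)
    then have "(norm (y - w))\<^sup>2 = (norm (y - ?p))\<^sup>2 + (norm (?p - w))\<^sup>2"
      using norm_add_Pythagorean[of "y - ?p" "?p - w"] metric_proj_orthogonal[OF Uk, of "?p - w" y]
      by (simp add: orthogonal_def)
    then show ?thesis
      using displacement_op_prod_metric_proj[where ks = "ks @ [k]" and U = U and y = y]
        snoc.prems True
      unfolding w_def by (smt (verit) zero_le_power2)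
  next
    case False
    then have "(norm (y - ?P i y))\<^sup>2 \<le> 2 ^ length ks * ((norm y)\<^sup>2 - (norm z)\<^sup>2)"
      using snoc unfolding z_def by auto
    also have "\<dots> \<le> 2 ^ length (ks @ [k]) * ((norm y)\<^sup>2 - (norm w)\<^sup>2)"
    proof (rule mult_mono)
      show "(norm y)\<^sup>2 - (norm z)\<^sup>2 \<le> (norm y)\<^sup>2 - (norm w)\<^sup>2"
        using norm_metric_proj_le[OF Uk, of z] by (simp add: wz power_mono)
      show "0 \<le> (norm y)\<^sup>2 - (norm z)\<^sup>2"
        unfolding z_def using norm_op_prod_metric_proj_le[where ks = ks and U = U and y = y] snoc.prems
        by (simp add: power_mono)
    qed simp_all
    finally show ?thesis by (simp only: w_def)
  qed
qed simp

subsection \<open>Linear regularity\<close>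

text \<open>The uniform boundedness principle for the functionals given by inner products with the
  elements of \<open>B\<close>, proved through Baire category.\<close>

lemma weakly_bounded_imp_bounded:
  fixes B :: "'a::{real_inner, complete_space} set"
  assumes "\<And>x. \<exists>c. \<forall>y\<in>B. \<bar>y \<bullet> x\<bar> \<le> c"
  shows "bounded B"
proof -
  define C where "C k = {x. \<forall>y\<in>B. \<bar>y \<bullet> x\<bar> \<le> real k}" for k
  have closed: "closed (C k)" for k
  proof -
    have "C k = (\<Inter>y\<in>B. {x. \<bar>y \<bullet> x\<bar> \<le> real k})" by (auto simp: C_def)
    then show ?thesis
      by (auto intro!: closed_INT closed_Collect_le continuous_intros)
  qed
  have UN: "\<Union>(range C) = UNIV"
  proof -
    have "\<exists>k. x \<in> C k" for x
    proof -
      obtain c where "\<forall>y\<in>B. \<bar>y \<bullet> x\<bar> \<le> c" using assms by blast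
      moreover obtain k where "c \<le> real k" using real_arch_simple by blast
      ultimately have "x \<in> C k" by (auto simp: C_def intro: order_trans)
      then show ?thesis ..
    qed
    then show ?thesis by auto
  qed
  \<comment> \<open>The closed sets \<open>C k\<close> cover a complete space, so they cannot all
    have empty interior.\<close>
  have "\<exists>k. interior (C k) \<noteq> {}"
  proof (rule ccontr)
    assume "\<nexists>k. interior (C k) \<noteq> {}"
    then have "euclidean interior_of \<Union>(range C) = {}"
      using Met_TC.metric_Baire_category_alt[where 'a = 'a, of "range C"] closed
      by (auto simp: complete_UNIV)
    then show False unfolding UN by simp
  qed
  then obtain k x r where r: "r > 0" "cball x r \<subseteq> C k"
    by (metis ex_in_conv mem_interior_cball)
  have "norm y \<le> 2 * real k / r" if y: "y \<in> B" for y
  proof (cases "y = 0")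
    case True
    then show ?thesis using r(1) by simp
  next
    case False
    \<comment> \<open>The inner products of \<open>y\<close> with these two points of the ball
      differ by \<open>r * norm y\<close>, and each is at most \<open>k\<close> in absolute
      value.\<close>
    have "x + (r / norm y) *\<^sub>R y \<in> C k" "x \<in> C k"
      using r False by (auto simp: dist_norm subset_iff)
    then have "\<bar>y \<bullet> (x + (r / norm y) *\<^sub>R y)\<bar> \<le> real k" "\<bar>y \<bullet> x\<bar> \<le> real k"
      using y unfolding C_def by blast+
    moreover have "y \<bullet> (x + (r / norm y) *\<^sub>R y) = y \<bullet> x + r * norm y"
      using False by (simp add: inner_add_right power2_eq_square flip: power2_norm_eq_inner)
    ultimately have "r * norm y \<le> 2 * real k" by linarith
    then show ?thesis using r(1) by (simp add: field_simps)
  qed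
  then show ?thesis unfolding bounded_iff by blast
qed

lemma subspace_set_sum:
  fixes V :: "'i \<Rightarrow> 'a::real_vector set"
  assumes "finite I" "\<And>i. i \<in> I \<Longrightarrow> subspace (V i)"
  shows "subspace (\<Sum>i\<in>I. V i)"
  using assms
proof (induction I rule: finite_induct)
  case (insert i I)
  have "V i + sum V I = {x + y | x y. x \<in> V i \<and> y \<in> sum V I}"
    unfolding set_plus_def by blast
  moreover have "subspace \<dots>"
    using insert by (intro subspace_sums) auto
  ultimately show ?case using insert by simp
qed (simp add: set_zero)

text \<open>The residual \<open>r\<close> of \<open>y\<close> after projecting onto the closed sum
  is orthogonal to each summand, so it lies in every \<open>U i\<close>, hence in the intersection.
  There \<open>y\<close> is orthogonal to it, which forces \<open>r = 0\<close>.\<close>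

lemma orthogonal_comp_INT_subset_sum:
  fixes U :: "'i \<Rightarrow> 'a::{real_inner, complete_space} set"
  assumes "finite I" "\<And>i. i \<in> I \<Longrightarrow> subspace (U i) \<and> closed (U i)"
    and "closed (\<Sum>i\<in>I. orthogonal_comp (U i))"
  shows "orthogonal_comp (\<Inter>i\<in>I. U i) \<subseteq> (\<Sum>i\<in>I. orthogonal_comp (U i))"
proof
  define W where "W = (\<Sum>i\<in>I. orthogonal_comp (U i))"
  have W: "subspace W" "closed W"
    unfolding W_def using assms by (auto intro: subspace_set_sum subspace_orthogonal_comp)
  fix y assume y: "y \<in> orthogonal_comp (\<Inter>i\<in>I. U i)"
  define r where "r = y - metric_proj W y"
  have rW: "r \<bullet> w = 0" if "w \<in> W" for w
    unfolding r_def by (rule metric_proj_orthogonal[OF W that])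
  have "r \<in> U i" if i: "i \<in> I" for i
  proof -
    have "w \<in> W" if "w \<in> orthogonal_comp (U i)" for w
    proof -
      have "w = sum (\<lambda>j. if j = i then w else 0) I"
        using i assms(1) by simp
      then show ?thesis
        unfolding W_def set_sum_alt[OF assms(1)] using that
        by (intro CollectI exI[of _ "\<lambda>j. if j = i then w else 0"])
          (auto simp: subspace_0 subspace_orthogonal_comp)
    qed
    then have "r \<in> orthogonal_comp (orthogonal_comp (U i))"
      using rW by (auto simp: orthogonal_comp_def orthogonal_def inner_commute)
    then show ?thesis
      using orthogonal_comp_orthogonal_comp assms(2)[OF i] by blast
  qed
  then have "r \<bullet> y = 0"
    using y by (auto simp: orthogonal_comp_def orthogonal_def)
  moreover have "r \<bullet> metric_proj W y = 0"
    by (intro rW metric_proj_mem W)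
  ultimately have "r \<bullet> r = 0"
    by (simp add: r_def inner_diff_right)
  then have "y = metric_proj W y" by (simp add: r_def)
  then show "y \<in> (\<Sum>i\<in>I. orthogonal_comp (U i))"
    using metric_proj_mem[OF W] unfolding W_def by metis
qed

lemma linear_regularity_subspaces:
  fixes U :: "'i \<Rightarrow> 'a::{real_inner, complete_space} set"
  assumes "finite I" and U: "\<And>i. i \<in> I \<Longrightarrow> subspace (U i) \<and> closed (U i)"
    and "closed (\<Sum>i\<in>I. orthogonal_comp (U i))"
  shows "\<exists>K\<ge>0. \<forall>y\<in>orthogonal_comp (\<Inter>i\<in>I. U i).
    norm y \<le> K * (\<Sum>i\<in>I. norm (y - metric_proj (U i) y))"
proof -
  define M where "M = (\<Inter>i\<in>I. U i)"
  define N where "N y = (\<Sum>i\<in>I. norm (y - metric_proj (U i) y))" for y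
  define B where "B = {y \<in> orthogonal_comp M. N y \<le> 1}"
  have M: "subspace M" "closed M"
    unfolding M_def using U by (auto intro: subspace_Int closed_INT)
  have "\<exists>c. \<forall>y\<in>B. \<bar>y \<bullet> x\<bar> \<le> c" for x
  proof -
    have "x - metric_proj M x \<in> orthogonal_comp M"
      using metric_proj_orthogonal[OF M] by (auto simp: orthogonal_comp_def orthogonal_def inner_commute)
    then have "x - metric_proj M x \<in> (\<Sum>i\<in>I. orthogonal_comp (U i))"
      using orthogonal_comp_INT_subset_sum[OF assms] unfolding M_def by blast
    then obtain w where w: "x - metric_proj M x = sum w I"
      "\<And>i. i \<in> I \<Longrightarrow> w i \<in> orthogonal_comp (U i)"
      unfolding set_sum_alt[OF assms(1)] by blast
    \<comment> \<open>The bound depends on \<open>x\<close> alone: \<open>w i\<close> is orthogonal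
      to \<open>U i\<close>, so it only sees the residual of \<open>y\<close> at \<open>U i\<close>,
      whose norm is at most 1 on \<open>B\<close>.\<close>
    have "\<bar>y \<bullet> x\<bar> \<le> (\<Sum>i\<in>I. norm (w i))" if y: "y \<in> B" for y
    proof -
      have "y \<bullet> metric_proj M x = 0"
        using y metric_proj_mem[OF M] by (auto simp: B_def orthogonal_comp_def orthogonal_def inner_commute)
      then have "y \<bullet> x = (\<Sum>i\<in>I. y \<bullet> w i)"
        using w(1) by (metis diff_zero inner_diff_right inner_sum_right)
      also have "\<dots> = (\<Sum>i\<in>I. (y - metric_proj (U i) y) \<bullet> w i)"
      proof (rule sum.cong)
        fix i assume i: "i \<in> I"
        then have "metric_proj (U i) y \<bullet> w i = 0"
          using w(2)[OF i] U[OF i] metric_proj_mem by (auto simp: orthogonal_comp_def orthogonal_def)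
        then show "y \<bullet> w i = (y - metric_proj (U i) y) \<bullet> w i"
          by (simp add: inner_diff_left)
      qed simp
      finally have "\<bar>y \<bullet> x\<bar> \<le> (\<Sum>i\<in>I. \<bar>(y - metric_proj (U i) y) \<bullet> w i\<bar>)"
        by simp
      also have "\<dots> \<le> (\<Sum>i\<in>I. 1 * norm (w i))"
      proof (rule sum_mono)
        fix i assume i: "i \<in> I"
        have "norm (y - metric_proj (U i) y) \<le> N y"
          unfolding N_def using i assms(1) by (intro member_le_sum) auto
        then have "norm (y - metric_proj (U i) y) \<le> 1"
          using y by (simp add: B_def)
        then show "\<bar>(y - metric_proj (U i) y) \<bullet> w i\<bar> \<le> 1 * norm (w i)"
          using Cauchy_Schwarz_ineq2 by (meson order_trans mult_right_mono norm_ge_zero)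
      qed
      finally show ?thesis by simp
    qed
    then show ?thesis by blast
  qed
  then have "bounded B" by (rule weakly_bounded_imp_bounded)
  then obtain K where K: "K > 0" "\<And>y. y \<in> B \<Longrightarrow> norm y \<le> K"
    unfolding bounded_pos by blast
  have "norm y \<le> K * N y" if y: "y \<in> orthogonal_comp M" for y
  \<comment> \<open>Scaling into \<open>B\<close> divides by \<open>N y\<close>. If
    \<open>N y = 0\<close>, then \<open>y\<close> lies in both \<open>M\<close> and its complement
    and is zero.\<close>
  proof (cases "N y = 0")
    case True
    then have "\<forall>i\<in>I. norm (y - metric_proj (U i) y) = 0"
      unfolding N_def using assms(1) by (subst (asm) sum_nonneg_eq_0_iff) auto
    then have "\<forall>i\<in>I. y = metric_proj (U i) y" by simp
    then have "y \<in> M"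
      unfolding M_def using U metric_proj_mem by (metis INT_I)
    then have "y \<bullet> y = 0"
      using y by (auto simp: orthogonal_comp_def orthogonal_def)
    then show ?thesis using True by simp
  next
    case False
    have "N y \<ge> 0" unfolding N_def by (intro sum_nonneg) auto
    with False have pos: "N y > 0" by simp
    have "N ((1 / N y) *\<^sub>R y) = (\<Sum>i\<in>I. (1 / N y) * norm (y - metric_proj (U i) y))"
      unfolding N_def[of "(1 / N y) *\<^sub>R y"]
    proof (rule sum.cong)
      fix i assume i: "i \<in> I"
      have "(1 / N y) *\<^sub>R y - metric_proj (U i) ((1 / N y) *\<^sub>R y)
          = (1 / N y) *\<^sub>R (y - metric_proj (U i) y)"
        using U[OF i] by (simp add: linear_scale[OF linear_metric_proj] scaleR_diff_right)
      then show "norm ((1 / N y) *\<^sub>R y - metric_proj (U i) ((1 / N y) *\<^sub>R y))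
          = (1 / N y) * norm (y - metric_proj (U i) y)"
        using pos by simp
    qed simp
    also have "\<dots> = 1"
      using False by (simp add: N_def flip: sum_distrib_left sum_divide_distrib)
    finally have "(1 / N y) *\<^sub>R y \<in> B"
      unfolding B_def using y by (simp add: subspace_scale subspace_orthogonal_comp)
    from K(2)[OF this] show ?thesis
      using pos by (simp add: field_simps)
  qed
  then show ?thesis
    using K(1) unfolding M_def N_def by (intro exI[of _ K]) auto
qed

lemma op_prod_metric_proj_contraction:
  fixes U :: "'i \<Rightarrow> 'a::{real_inner, complete_space} set"
  assumes U: "\<And>i. i \<in> set ks \<Longrightarrow> subspace (U i) \<and> closed (U i)"
    and "closed (\<Sum>i\<in>set ks. orthogonal_comp (U i))"
  shows "\<exists>c\<ge>0. c < 1 \<and> (\<forall>y\<in>orthogonal_comp (\<Inter>i\<in>set ks. U i).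
    norm (op_prod (\<lambda>i. metric_proj (U i)) ks y) \<le> c * norm y)"
proof -
  let ?T = "op_prod (\<lambda>i. metric_proj (U i)) ks"
  obtain K where K: "K \<ge> 0" "\<And>y. y \<in> orthogonal_comp (\<Inter>i\<in>set ks. U i) \<Longrightarrow>
      norm y \<le> K * (\<Sum>i\<in>set ks. norm (y - metric_proj (U i) y))"
    using linear_regularity_subspaces[of "set ks" U] assms by blast
  \<comment> \<open>Regularity and the distance bounds give
    \<open>(norm y)\<^sup>2 \<le> L * D\<close>, with \<open>D\<close> the loss of squared norm;
    solving for \<open>norm (?T y)\<close> yields the factor \<open>sqrt (1 - 1 / L)\<close>. The
    summand 1 ensures \<open>L \<ge> 1\<close>.\<close>
  define L where "L = 1 + (K * card (set ks))\<^sup>2 * 2 ^ length ks"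
  have L: "L \<ge> 1" unfolding L_def by simp
  have "norm (?T y) \<le> sqrt (1 - 1 / L) * norm y"
    if y: "y \<in> orthogonal_comp (\<Inter>i\<in>set ks. U i)" for y
  proof -
    define D where "D = (norm y)\<^sup>2 - (norm (?T y))\<^sup>2"
    have D: "D \<ge> 0"
      unfolding D_def using norm_op_prod_metric_proj_le[OF U] by (simp add: power_mono)
    have "norm (y - metric_proj (U i) y) \<le> sqrt (2 ^ length ks * D)" if "i \<in> set ks" for i
      unfolding D_def using distance_le_norm_decrease_op_prod[where ks = ks and U = U and y = y] U that
      by (simp add: real_le_rsqrt)
    then have "(\<Sum>i\<in>set ks. norm (y - metric_proj (U i) y)) \<le> card (set ks) * sqrt (2 ^ length ks * D)"
      by (rule sum_bounded_above)
    then have "norm y \<le> K * (card (set ks) * sqrt (2 ^ length ks * D))"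
      using K(1) K(2)[OF y] by (meson mult_left_mono order_trans)
    then have "(norm y)\<^sup>2 \<le> (K * (card (set ks) * sqrt (2 ^ length ks * D)))\<^sup>2"
      by (simp add: power_mono)
    also have "\<dots> = (K * card (set ks))\<^sup>2 * 2 ^ length ks * D"
      using D by (simp add: power_mult_distrib)
    also have "\<dots> \<le> L * D"
      using D by (simp add: L_def algebra_simps)
    finally have "(norm (?T y))\<^sup>2 \<le> (1 - 1 / L) * (norm y)\<^sup>2"
      using L unfolding D_def by (simp add: field_simps)
    then have "sqrt ((norm (?T y))\<^sup>2) \<le> sqrt ((1 - 1 / L) * (norm y)\<^sup>2)"
      by (rule real_sqrt_le_mono)
    then show ?thesis by (simp add: real_sqrt_mult)
  qed
  moreover have "0 \<le> sqrt (1 - 1 / L)" "sqrt (1 - 1 / L) < 1"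
    using L by auto
  ultimately show ?thesis by blast
qed

subsection \<open>Circumcenters\<close>

lemma inner_constant_on_affine_hull:
  fixes A :: "'a::real_inner set"
  assumes "\<And>b. b \<in> A \<Longrightarrow> z \<bullet> b = c" "v \<in> affine hull A"
  shows "z \<bullet> v = c"
  using assms hull_minimal[of A "{v. z \<bullet> v = c}" affine] affine_hyperplane by blast

lemma ex_orthogonal_projection_span:
  fixes B :: "'a::real_inner set"
  assumes "finite B"
  shows "\<exists>p\<in>span B. \<forall>y\<in>span B. (x - p) \<bullet> y = 0"
proof -
  obtain C where C: "finite C" "span C = span B" "pairwise orthogonal C"
    using basis_orthogonal[OF assms] by blast
  \<comment> \<open>The Fourier sum along an orthogonal spanning set. If \<open>C\<close> contains
    the zero vector, its coefficient is 0, the value of division by zero.\<close>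
  define p where "p = (\<Sum>c\<in>C. (x \<bullet> c / (c \<bullet> c)) *\<^sub>R c)"
  have "p \<in> span C"
    unfolding p_def by (intro span_sum span_scale span_base)
  moreover have "(x - p) \<bullet> y = 0" if "y \<in> C" for y
  proof -
    have "p \<bullet> y = (\<Sum>c\<in>C. if c = y then x \<bullet> y else 0)"
      unfolding p_def inner_sum_left
      using C(3) that by (intro sum.cong) (auto simp: pairwise_def orthogonal_def)
    also have "\<dots> = x \<bullet> y" using C(1) that by simp
    finally show ?thesis by (simp add: inner_diff_left)
  qed
  then have "(x - p) \<bullet> y = 0" if "y \<in> span C" for y
    using orthogonal_to_span[OF that, of "x - p"] by (simp add: orthogonal_def)
  ultimately show ?thesis using C(2) by auto
qed

text \<open>The hull is a translate of its direction space by \<open>a\<close>; removing from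
  \<open>a\<close> its projection \<open>q\<close> onto that space leaves the foot of the
  perpendicular from the origin.\<close>

lemma ex_min_norm_affine_hull_finite:
  fixes A :: "'a::real_inner set"
  assumes "finite A" "A \<noteq> {}"
  shows "\<exists>p\<in>affine hull A. \<forall>v\<in>affine hull A. p \<bullet> (v - p) = 0"
proof -
  obtain a where a: "a \<in> A" using assms(2) by blast
  let ?V = "span ((\<lambda>b. -a + b) ` A)"
  have hull: "affine hull A = (\<lambda>v. a + v) ` ?V"
    using a by (intro affine_hull_span_gen hull_inc)
  obtain q where q: "q \<in> ?V" "\<And>y. y \<in> ?V \<Longrightarrow> (a - q) \<bullet> y = 0"
    using ex_orthogonal_projection_span[of "(\<lambda>b. -a + b) ` A" a] assms(1) by blast
  have "a - q \<in> affine hull A"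
    unfolding hull using image_eqI[of "a - q" "\<lambda>v. a + v" "-q"] span_neg[OF q(1)] by simp
  moreover have "(a - q) \<bullet> (v - (a - q)) = 0" if "v \<in> affine hull A" for v
  proof -
    obtain w where "v = a + w" "w \<in> ?V" using \<open>v \<in> affine hull A\<close>[unfolded hull] by (rule imageE)
    then show ?thesis using q(2)[OF span_add[OF _ q(1), of w]] by simp
  qed
  ultimately show ?thesis by blast
qed

text \<open>Since all points of the orbit have the same norm, the circumcenter is the point of minimal
  norm of the affine hull.\<close>

lemma CC_mem_orthogonal:
  fixes S :: "('a::real_inner \<Rightarrow> 'a) set"
  assumes "finite S" "S \<noteq> {}" and norm_eq: "\<And>T. T \<in> S \<Longrightarrow> norm (T x) = r"
  shows "CC S x \<in> affine hull ((\<lambda>T. T x) ` S) \<and>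
    (\<forall>v\<in>affine hull ((\<lambda>T. T x) ` S). CC S x \<bullet> (v - CC S x) = 0)"
proof -
  let ?A = "(\<lambda>T. T x) ` S"
  obtain p where p: "p \<in> affine hull ?A" "\<And>v. v \<in> affine hull ?A \<Longrightarrow> p \<bullet> (v - p) = 0"
    using ex_min_norm_affine_hull_finite[of ?A] assms by blast
  \<comment> \<open>With all \<open>norm (T x)\<close> equal to \<open>r\<close>, being equidistant
    from the orbit is the same as having constant inner product with it.\<close>
  have expand: "(norm (q - T x))\<^sup>2 = (norm q)\<^sup>2 - 2 * (q \<bullet> T x) + r\<^sup>2" if "T \<in> S" for q T
    using norm_eq[OF that, symmetric]
    by (simp add: power2_norm_eq_inner inner_simps inner_commute)
  have "CC S x = p"
    unfolding CC_def
  proof (rule the_equality)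
    have "norm (p - T x) = norm (p - T' x)" if "T \<in> S" "T' \<in> S" for T T'
    proof -
      have "p \<bullet> T x = p \<bullet> p" "p \<bullet> T' x = p \<bullet> p"
        using p(2)[of "T x"] p(2)[of "T' x"] that
        by (auto simp: inner_diff_right hull_inc)
      then have "(norm (p - T x))\<^sup>2 = (norm (p - T' x))\<^sup>2"
        using expand that by simp
      then show ?thesis by simp
    qed
    then have "is_singleton ((\<lambda>T. norm (p - T x)) ` S)"
      using assms(2) by (intro is_singletonI') blast+
    then show "p \<in> affine hull ?A \<and> is_singleton ((\<lambda>T. norm (p - T x)) ` S)"
      using p(1) by blast
  next
    fix q assume q: "q \<in> affine hull ?A \<and> is_singleton ((\<lambda>T. norm (q - T x)) ` S)"
    then obtain c where c: "\<And>T. T \<in> S \<Longrightarrow> norm (q - T x) = c"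
      unfolding is_singleton_def by blast
    have qb: "q \<bullet> b = ((norm q)\<^sup>2 + r\<^sup>2 - c\<^sup>2) / 2" if "b \<in> ?A" for b
    proof -
      obtain T where "T \<in> S" "b = T x" using \<open>b \<in> ?A\<close> by blast
      then show ?thesis using expand[of T q] c[of T] by simp
    qed
    have const: "q \<bullet> v = ((norm q)\<^sup>2 + r\<^sup>2 - c\<^sup>2) / 2" if "v \<in> affine hull ?A" for v
      using qb that by (rule inner_constant_on_affine_hull)
    \<comment> \<open>A second candidate \<open>q\<close> has constant inner product on the hull,
      which contains both \<open>p\<close> and \<open>q\<close>; together with the minimality of
      \<open>p\<close> this gives \<open>p = q\<close>.\<close>
    have "q \<bullet> p = q \<bullet> q"
      using const[OF p(1)] const[OF conjunct1[OF q]] by (rule trans[OF _ sym])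
    moreover have "p \<bullet> (q - p) = 0"
      using p(2) q by blast
    ultimately have "(p - q) \<bullet> (p - q) = 0"
      by (simp add: inner_diff_left inner_diff_right inner_commute)
    then show "q = p" by simp
  qed
  then show ?thesis using p by blast
qed

lemma affine_hull_linear_image_mem:
  assumes "linear f" "v \<in> affine hull A"
  shows "f v \<in> affine hull (f ` A)"
proof -
  have "affine {v. f v \<in> affine hull (f ` A)}"
    using affine_affine_hull[of "f ` A"] unfolding affine_def
    by (simp add: linear_add[OF assms(1)] linear_scale[OF assms(1)])
  moreover have "A \<subseteq> {v. f v \<in> affine hull (f ` A)}"
    by (auto simp: hull_inc)
  ultimately show ?thesis
    using assms(2) hull_minimal by blast
qed

lemma id_in_Psi: "id \<in> Psi m U"
  unfolding Psi_def by (auto intro!: exI[of _ "[]"])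

lemma Psi_mono_Suc: "Psi k U \<subseteq> Psi (Suc k) U"
  unfolding Psi_def by fastforce

lemma reflector_comp_in_Psi:
  assumes "T \<in> Psi k U"
  shows "reflector (U (Suc k)) \<circ> T \<in> Psi (Suc k) U"
proof -
  obtain ks where ks: "T = op_prod (\<lambda>i. reflector (U i)) ks" "length ks \<le> k" "set ks \<subseteq> {1..k}"
    "sorted_wrt (<) ks"
    using assms unfolding Psi_def by blast
  have "sorted_wrt (<) (ks @ [Suc k])"
    using ks by (force simp: sorted_wrt_append)
  then show ?thesis
    unfolding Psi_def using ks
    by (intro CollectI exI[of _ "ks @ [Suc k]"]) auto
qed

text \<open>A projected point is the midpoint of the point and its reflection. At stage
  \<open>Suc k\<close> a word either stays as it is or gets the new reflector appended, so only
  words with increasing indices arise.\<close>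

lemma op_prod_metric_proj_in_affine_hull_Psi:
  fixes U :: "nat \<Rightarrow> 'a::{real_inner, complete_space} set"
  assumes "\<And>i. i \<in> {1..k} \<Longrightarrow> subspace (U i) \<and> closed (U i)"
  shows "op_prod (\<lambda>i. metric_proj (U i)) [1..<k + 1] x \<in> affine hull ((\<lambda>T. T x) ` Psi k U)"
  using assms
proof (induction k)
  case 0
  show ?case using id_in_Psi[of 0 U] by (auto intro!: hull_inc image_eqI[of _ _ id])
next
  case (Suc k)
  let ?A = "\<lambda>k. (\<lambda>T. T x) ` Psi k U" and ?R = "reflector (U (Suc k))"
  define v where "v = op_prod (\<lambda>i. metric_proj (U i)) [1..<k + 1] x"
  have v: "v \<in> affine hull (?A k)"
    using Suc unfolding v_def by auto
  have "affine hull (?A k) \<subseteq> affine hull (?A (Suc k))"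
    by (intro hull_mono image_mono Psi_mono_Suc)
  then have v': "v \<in> affine hull (?A (Suc k))" using v by blast
  have "?R ` ?A k \<subseteq> ?A (Suc k)"
  proof clarify
    fix T assume "T \<in> Psi k U"
    from imageI[OF reflector_comp_in_Psi[OF this], of "\<lambda>T. T x"]
    show "?R (T x) \<in> ?A (Suc k)" by simp
  qed
  moreover have "?R v \<in> affine hull (?R ` ?A k)"
    using Suc.prems by (intro affine_hull_linear_image_mem[OF linear_reflector v]) auto
  ultimately have "?R v \<in> affine hull (?A (Suc k))"
    by (meson hull_mono subsetD)
  then have "(1/2) *\<^sub>R v + (1/2) *\<^sub>R ?R v \<in> affine hull (?A (Suc k))"
    using v' by (simp add: mem_affine[OF affine_affine_hull])
  moreover have "(1/2) *\<^sub>R v + (1/2) *\<^sub>R ?R v = metric_proj (U (Suc k)) v"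
    by (simp add: reflector_def algebra_simps)
  ultimately show ?case by (simp add: v_def)
qed

theorem theorem6p23:
  fixes U :: "nat \<Rightarrow> 'a::{real_inner, complete_space} set"
    and n m :: nat
    and S :: "('a \<Rightarrow> 'a) set"
    and \<gamma> :: real
  assumes "n \<ge> 1"
    and "m = 2 * n - 1"
    and "\<And>i. i \<in> {1..n} \<Longrightarrow> subspace (U i) \<and> closed (U i)"
    and "closed (\<Sum>i\<in>{1..n}. orthogonal_comp (U i))"
    and "\<And>i. i \<in> {1..n - 1} \<Longrightarrow> U (n + i) = U (n - i)"
    and "finite S"
    and "Psi m U \<subseteq> S"
    and "S \<subseteq> Omega m U"
    and "\<gamma> = onorm (op_prod (\<lambda>i. metric_proj (U i)) [1..<n + 1] \<circ>
                    metric_proj (orthogonal_comp (\<Inter>i\<in>{1..n}. U i)))"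
  shows "0 \<le> \<gamma> \<and> \<gamma> < 1 \<and> Fix (CC S) = (\<Inter>i\<in>{1..m}. U i) \<and> BAM (\<gamma>\<^sup>2) (CC S)"
proof -

  \<comment> \<open>Reduction of the index range to the first \<open>n\<close> subspaces\<close>
  let ?P = "\<lambda>i. metric_proj (U i)"
  define M where "M = (\<Inter>i\<in>{1..n}. U i)"
  define T where "T = op_prod ?P [1..<n + 1]"
  define T' where "T' = op_prod ?P (rev [1..<n + 1])"
  have set_upt: "set [1..<n + 1] = {1..n}" by auto
  have U: "\<And>i. i \<in> set [1..<n + 1] \<Longrightarrow> subspace (U i) \<and> closed (U i)"
    using assms(3) unfolding set_upt .
  have M: "subspace M" "closed M"
    unfolding M_def using assms(3) by (auto intro: subspace_Int closed_INT)
  \<comment> \<open>An index \<open>i > n\<close> mirrors to \<open>n - (i - n)\<close>, which is at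
    least 1 since \<open>i \<le> 2 * n - 1\<close>.\<close>
  have fold_U: "\<exists>j\<in>{1..n}. U i = U j" if "i \<in> {1..m}" for i
  proof (cases "i \<le> n")
    case False
    then have "U (n + (i - n)) = U (n - (i - n))"
      using that assms(2) by (intro assms(5)) auto
    moreover have "n - (i - n) \<in> {1..n}" using that assms(2) False by auto
    ultimately show ?thesis using False by (intro bexI[of _ "n - (i - n)"]) auto
  qed (use that in auto)
  have Um: "subspace (U i) \<and> closed (U i)" if "i \<in> {1..m}" for i
    using fold_U[OF that] assms(3) by metis
  have M_eq: "M = (\<Inter>i\<in>{1..m}. U i)"
  proof
    show "M \<subseteq> (\<Inter>i\<in>{1..m}. U i)"
      unfolding M_def using fold_U by fastforce
    have "{1..n} \<subseteq> {1..m}" using assms(1,2) by auto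
    then show "(\<Inter>i\<in>{1..m}. U i) \<subseteq> M"
      unfolding M_def by blast
  qed

  \<comment> \<open>The constant \<open>\<gamma>\<close> as a contraction factor\<close>
  have perp_proj: "metric_proj (orthogonal_comp M) = (\<lambda>x. x - metric_proj M x)"
    using metric_proj_orthogonal_comp[OF M] by blast
  have perp_mem: "x - metric_proj M x \<in> orthogonal_comp M" for x
    using metric_proj_orthogonal[OF M] by (auto simp: orthogonal_comp_def orthogonal_def inner_commute)
  have blT: "bounded_linear T"
    unfolding T_def by (rule bounded_linear_op_prod_metric_proj[OF U])
  have bl: "bounded_linear (T \<circ> metric_proj (orthogonal_comp M))"
    unfolding perp_proj comp_def
    by (intro bounded_linear_compose[OF blT] bounded_linear_sub bounded_linear_ident
        bounded_linear_metric_proj M)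
  have gamma: "\<gamma> = onorm (T \<circ> metric_proj (orthogonal_comp M))"
    unfolding assms(9) T_def M_def ..
  have gamma0: "0 \<le> \<gamma>"
    unfolding gamma by (rule onorm_pos_le[OF bl])
  obtain c where c: "c \<ge> 0" "c < 1" "\<And>y. y \<in> orthogonal_comp M \<Longrightarrow> norm (T y) \<le> c * norm y"
    using op_prod_metric_proj_contraction[of "[1..<n + 1]" U] assms(3,4)
    unfolding set_upt M_def T_def by blast
  have "\<gamma> \<le> c"
    unfolding gamma
  proof (rule onorm_bound)
    fix x
    have "norm (T (x - metric_proj M x)) \<le> c * norm (x - metric_proj M x)"
      by (intro c perp_mem)
    also have "norm (x - metric_proj M x) \<le> norm x"
      using metric_proj_Pythagorean[OF M, of x] by (simp add: power2_le_imp_le)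
    finally show "norm ((T \<circ> metric_proj (orthogonal_comp M)) x) \<le> c * norm x"
      using c(1) by (simp add: perp_proj mult_left_mono)
  qed (rule c)
  with c have gamma1: "\<gamma> < 1" by simp
  \<comment> \<open>A vector of the complement is its own projection there, so the operator norm
    applies to \<open>T\<close> directly.\<close>
  have normT: "norm (T y) \<le> \<gamma> * norm y" if "y \<in> orthogonal_comp M" for y
  proof -
    have "metric_proj M y = 0"
      using that M by (intro subspace_projection_unique)
        (auto simp: subspace_0 orthogonal_comp_def orthogonal_def inner_commute)
    then show ?thesis
      using onorm[OF bl, of y] unfolding gamma perp_proj by simp
  qed

  \<comment> \<open>The palindromic product\<close>
  have adj: "T' v \<bullet> w = v \<bullet> T w" for v w
    using op_prod_metric_proj_inner[of "rev [1..<n + 1]" U v w] U by (simp only: T_def T'_def set_rev rev_rev_ident)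
  have fixed: "T z = z" "T' z = z" if "z \<in> M" for z
  proof -
    have "?P i z = z" if "i \<in> {1..n}" for i
      using that \<open>z \<in> M\<close> assms(3)[OF that] metric_proj_id unfolding M_def by blast
    then show "T z = z" "T' z = z"
      unfolding T_def T'_def by (auto intro!: op_prod_fixed simp del: upt_Suc)
  qed
  \<comment> \<open>For \<open>w = T' (T y)\<close>, moving \<open>T'\<close> across gives
    \<open>w \<bullet> w = T y \<bullet> T w\<close>, and each factor contributes one
    \<open>\<gamma>\<close> once \<open>w\<close> is known to lie in the complement of
    \<open>M\<close>. The case \<open>w = 0\<close> is split off because \<open>norm w\<close> is
    cancelled.\<close>
  have contr: "norm (T' (T y)) \<le> \<gamma>\<^sup>2 * norm y" if y: "y \<in> orthogonal_comp M" for y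
  proof (cases "T' (T y) = 0")
    case False
    define w where "w = T' (T y)"
    have "w \<bullet> z = 0" if z: "z \<in> M" for z
    proof -
      have "w \<bullet> z = T y \<bullet> z"
        unfolding w_def adj fixed(1)[OF z] ..
      also have "\<dots> = T' z \<bullet> y"
        by (metis adj inner_commute)
      also have "\<dots> = 0"
        using y z unfolding fixed(2)[OF z] by (auto simp: orthogonal_comp_def orthogonal_def)
      finally show ?thesis .
    qed
    then have w: "w \<in> orthogonal_comp M"
      by (auto simp: orthogonal_comp_def orthogonal_def inner_commute)
    have "norm w * norm w = T y \<bullet> T w"
      by (metis adj w_def power2_eq_square power2_norm_eq_inner)
    also have "\<dots> \<le> norm (T y) * norm (T w)"
      by (rule norm_cauchy_schwarz)
    also have "\<dots> \<le> (\<gamma> * norm y) * (\<gamma> * norm w)"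
      using normT[OF y] normT[OF w] gamma0 by (intro mult_mono) auto
    finally have "norm w * norm w \<le> (\<gamma>\<^sup>2 * norm y) * norm w"
      by (simp add: power2_eq_square mult_ac)
    then show ?thesis
      unfolding w_def by (rule mult_right_le_imp_le) (use False in simp)
  qed simp
  have palindrome: "op_prod ?P [1..<m + 1] = T' \<circ> T"
  proof -
    have Un: "subspace (U n)" "closed (U n)" using assms(1,3) by auto
    have idem: "?P n \<circ> ?P n = ?P n"
      using metric_proj_id[OF Un metric_proj_mem[OF Un]] by (simp add: fun_eq_iff)
    have "m + 1 = 2 * n" using assms(1,2) by simp
    then show ?thesis
      using op_prod_palindrome[where F = metric_proj, OF assms(1) assms(5) idem]
      by (simp only: T_def T'_def)
  qed

  \<comment> \<open>The circumcenter mapping\<close>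
  let ?A = "\<lambda>x. affine hull ((\<lambda>T. T x) ` S)"
  have id_S: "id \<in> S" using id_in_Psi assms(7) by blast
  have CC: "CC S x \<in> ?A x" "\<And>v. v \<in> ?A x \<Longrightarrow> CC S x \<bullet> (v - CC S x) = 0" for x
  proof -
    have "norm (R x) = norm x" if "R \<in> S" for R
    proof -
      obtain ks where ks: "R = op_prod (\<lambda>i. reflector (U i)) ks" "set ks \<subseteq> {1..m}"
        using \<open>R \<in> S\<close> assms(8) unfolding Omega_def by blast
      show ?thesis
        unfolding ks(1) using ks(2) by (intro norm_op_prod_reflector Um) blast
    qed
    with assms(6) have "CC S x \<in> ?A x \<and> (\<forall>v\<in>?A x. CC S x \<bullet> (v - CC S x) = 0)"
      by (intro CC_mem_orthogonal[where r = "norm x"]) (use id_S in auto)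
    then show "CC S x \<in> ?A x" "\<And>v. v \<in> ?A x \<Longrightarrow> CC S x \<bullet> (v - CC S x) = 0"
      by blast+
  qed
  \<comment> \<open>In other words, the hull lies in the translate by \<open>x\<close> of the
    complement of \<open>M\<close>.\<close>
  have inner_hull: "z \<bullet> v = z \<bullet> x" if z: "z \<in> M" and v: "v \<in> ?A x" for z v x
  proof (rule inner_constant_on_affine_hull[OF _ v])
    fix b assume "b \<in> (\<lambda>T. T x) ` S"
    then obtain ks where ks: "b = op_prod (\<lambda>i. reflector (U i)) ks x" "set ks \<subseteq> {1..m}"
      using assms(8) unfolding Omega_def by blast
    show "z \<bullet> b = z \<bullet> x"
      unfolding ks(1) using ks(2) Um z unfolding M_eq by (intro op_prod_reflector_inner_fixed) blast
  qed
  have proj_CC: "metric_proj M (CC S x) = metric_proj M x" for x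
  proof (rule subspace_projection_unique[OF M(1) metric_proj_mem[OF M]])
    fix y assume y: "y \<in> M"
    show "(CC S x - metric_proj M x) \<bullet> y = 0"
      using inner_hull[OF y CC(1), of x] metric_proj_orthogonal[OF M y, of x]
      by (simp add: inner_diff_right inner_commute[of _ y])
  qed
  have bound: "norm (CC S x - metric_proj M x) \<le> \<gamma>\<^sup>2 * norm (x - metric_proj M x)" for x
  proof -
    define z where "z = metric_proj M x"
    define v where "v = op_prod ?P [1..<m + 1] x"
    have z: "z \<in> M" unfolding z_def by (rule metric_proj_mem[OF M])
    have "v \<in> affine hull ((\<lambda>T. T x) ` Psi m U)"
      unfolding v_def by (rule op_prod_metric_proj_in_affine_hull_Psi[OF Um])
    then have v: "v \<in> ?A x"
      by (rule subsetD[OF hull_mono[OF image_mono[OF assms(7)]]])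
    \<comment> \<open>\<open>CC S x\<close> is the point of the hull nearest to the origin. The
      inner product with \<open>z\<close> is constant on the hull, so the origin may be replaced by
      \<open>z\<close>.\<close>
    have "(v - CC S x) \<bullet> (CC S x - z) = 0"
      using CC(2)[OF v] inner_hull[OF z v] inner_hull[OF z CC(1), of x]
      by (simp add: inner_diff_left inner_diff_right inner_commute)
    then have "(norm (v - z))\<^sup>2 = (norm (v - CC S x))\<^sup>2 + (norm (CC S x - z))\<^sup>2"
      using norm_add_Pythagorean[of "v - CC S x" "CC S x - z"] by (simp add: orthogonal_def)
    then have "norm (CC S x - z) \<le> norm (v - z)"
      by (simp add: power2_le_imp_le)
    also have "v - z = T' (T (x - z))"
    proof -
      have "linear (T' \<circ> T)"
        unfolding T_def T'_def
        using U by (intro linear_compose linear_op_prod linear_metric_proj) (auto simp del: upt_Suc)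
      then have "T' (T (x - z)) = T' (T x) - T' (T z)"
        using linear_diff[of "T' \<circ> T"] by simp
      then show ?thesis
        unfolding v_def palindrome using fixed[OF z] by simp
    qed
    also have "norm (T' (T (x - z))) \<le> \<gamma>\<^sup>2 * norm (x - z)"
      unfolding z_def by (intro contr perp_mem)
    finally show ?thesis unfolding z_def .
  qed
  have gamma2: "\<gamma>\<^sup>2 < 1"
    using gamma0 gamma1 by (simp add: power_less_one_iff)
  \<comment> \<open>Both inclusions come from \<open>bound\<close>: its right side vanishes on
    \<open>M\<close>, and at a fixed point \<open>\<gamma>\<^sup>2 < 1\<close> forces the distance
    to \<open>M\<close> to be zero.\<close>
  have Fix: "Fix (CC S) = M"
  proof
    show "M \<subseteq> Fix (CC S)"
    proof
      fix x assume "x \<in> M"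
      then show "x \<in> Fix (CC S)"
        using bound[of x] by (simp add: Fix_def metric_proj_id[OF M])
    qed
    show "Fix (CC S) \<subseteq> M"
    proof
      fix x assume "x \<in> Fix (CC S)"
      then have "(1 - \<gamma>\<^sup>2) * norm (x - metric_proj M x) \<le> 0"
        using bound[of x] by (simp add: Fix_def algebra_simps)
      then have "x = metric_proj M x"
        using gamma2 by (simp add: mult_le_0_iff)
      then show "x \<in> M" using metric_proj_mem[OF M, of x] by simp
    qed
  qed
  have "BAM (\<gamma>\<^sup>2) (CC S)"
    unfolding BAM_def Fix
    using M subspace_0[OF M(1)] subspace_imp_convex[OF M(1)] gamma2 proj_CC bound by auto
  then show ?thesis
    using gamma0 gamma1 Fix M_eq by simp
qed

end
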